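(* (1) Given $w^1,\dots,w^d\in\mathbb{R}^2$, take $\widetilde w^k=w^k_1-w^k_2$ for $k\in\{1,\dots,d\}$, and suppose the indices have been sorted so that $\widetilde w^1\le\cdots\le\widetilde w^d$. Then for $x\in\Delta^2$ and $z\in\Delta^d$, $$\mathsf{Transport}(x,z;w^1,\dots,w^d)=\min_{K=1}^d\left(\widetilde w^Kx_1+\sum_{k=1}^Kw^k_2z_k+\sum_{k=K+1}^d(w^k_1-\widetilde w^K)z_k\right).$$ Moreover, a $K\in\{1,\dots,d\}$ attaining the minimum on the right-hand side can be found in $\mathcal{O}(d)$ time. (2) Therefore, suppose $D=(\Delta^2)^\tau$ and $f^k(x)=\sum_{i=1}^\tau\sum_{j=1}^2w^k_{i,j}x_{i,j}+b^k$ for $k\in\{1,\dots,d\}$. For each $i\in\{1,\dots,\tau\}$ take $\widetilde w^k_i=w^k_{i,1}-w^k_{i,2}$ and let $\sigma_i$ be a permutation of $\{1,\dots,d\}$ with $\widetilde w^{\sigma_i(1)}_i\le\cdots\le\widetilde w^{\sigma_i(d)}_i$. Then, for $(x,y,z)\in D\times\mathbb{R}\times\Delta^d$, the constraints $$y\le\alpha\cdot x+\sum_{k=1}^d\left(\max_{x^k\in D}\{(w^k-\alpha)\cdot x^k\}+b^k\right)z_k\qquad\forall\alpha\in\mathbb{R}^{2\tau}$$ are equivalent to $$y\le\sum_{i=1}^\tau\left(\widetilde w^{\sigma_i(K(i))}_ix_{i,1}+\sum_{k=1}^{K(i)}w^{\sigma_i(k)}_{i,2}z_{\sigma_i(k)}+\sum_{k=K(i)+1}^d\left(w^{\sigma_i(k)}_{i,1}-\widetilde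 w^{\sigma_i(K(i))}_i\right)z_{\sigma_i(k)}\right)+\sum_{k=1}^db^kz_k$$ for all mappings $K:\{1,\dots,\tau\}\to\{1,\dots,d\}$. Furthermore, none of the constraints in this last family are redundant.
   Context: $\Delta^n=\{v\in\mathbb{R}^n_{\ge0}:\sum_iv_i=1\}$. Elements of $D=(\Delta^2)^\tau$ are written $x=((x_{i,j})_{j=1}^{2})_{i=1}^\tau$, and vectors $w^k,\alpha\in\mathbb{R}^{2\tau}$ are indexed in the same way. For $x\in\Delta^p$, $z\in\Delta^d$ and $w^1,\dots,w^d\in\mathbb{R}^p$, $$\mathsf{Transport}(x,z;w^1,\dots,w^d)=\max_{\beta\ge0}\left\{\sum_{k=1}^d\sum_{j=1}^pw^k_j\beta^k_j:\ \sum_{k=1}^d\beta^k_j=x_j\ \forall j,\ \sum_{j=1}^p\beta^k_j=z_k\ \forall k\right\}.$$ Non-redundancy of a constraint of the family means: removing it from the family (together with any other constraints of the family that cut out the same subset of $D\times\mathbb{R}\times\Delta^d$) strictly enlarges the set of points of $D\times\mathbb{R}\times\Delta^d$ satisfying the family. *)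

theory Defs
  imports "HOL-Analysis.Analysis" "HOL-Library.Landau_Symbols"
begin

text \<open>
  Vectors in $\mathbb{R}^n$ are functions on the index set \<open>{1..n}\<close>. Points of a simplex are
  extensional, so that set-theoretic comparison of sets of points ignores irrelevant indices.
\<close>

definition std_simplex :: "nat \<Rightarrow> (nat \<Rightarrow> real) set" where
  "std_simplex n = {v \<in> {1..n} \<rightarrow>\<^sub>E {0..}. (\<Sum>i=1..n. v i) = 1}"

definition simplex2_power :: "nat \<Rightarrow> (nat \<Rightarrow> nat \<Rightarrow> real) set" where
  "simplex2_power \<tau> = {1..\<tau>} \<rightarrow>\<^sub>E std_simplex 2"

definition dot :: "nat \<Rightarrow> (nat \<Rightarrow> nat \<Rightarrow> real) \<Rightarrow> (nat \<Rightarrow> nat \<Rightarrow> real) \<Rightarrow> real" where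
  "dot \<tau> a x = (\<Sum>i=1..\<tau>. \<Sum>j=1..2. a i j * x i j)"

definition transport_feasible ::
    "nat \<Rightarrow> nat \<Rightarrow> (nat \<Rightarrow> real) \<Rightarrow> (nat \<Rightarrow> real) \<Rightarrow> (nat \<Rightarrow> nat \<Rightarrow> real) \<Rightarrow> bool" where
  "transport_feasible p d x z \<beta> \<longleftrightarrow>
     (\<forall>k\<in>{1..d}. \<forall>j\<in>{1..p}. 0 \<le> \<beta> k j) \<and>
     (\<forall>j\<in>{1..p}. (\<Sum>k=1..d. \<beta> k j) = x j) \<and>
     (\<forall>k\<in>{1..d}. (\<Sum>j=1..p. \<beta> k j) = z k)"

text \<open>
  \<open>GREATEST\<close> rather than a supremum: its value is determined only if the maximum is attained.
  The entry \<open>w k j\<close> is $w^k_j$.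
\<close>

definition transport ::
    "nat \<Rightarrow> nat \<Rightarrow> (nat \<Rightarrow> real) \<Rightarrow> (nat \<Rightarrow> real) \<Rightarrow> (nat \<Rightarrow> nat \<Rightarrow> real) \<Rightarrow> real" where
  "transport p d x z w =
     (GREATEST v. \<exists>\<beta>. transport_feasible p d x z \<beta> \<and> v = (\<Sum>k=1..d. \<Sum>j=1..p. w k j * \<beta> k j))"

definition wdiff :: "(nat \<Rightarrow> nat \<Rightarrow> real) \<Rightarrow> nat \<Rightarrow> real" where
  "wdiff w k = w k 1 - w k 2"

definition threshold_value ::
    "nat \<Rightarrow> (nat \<Rightarrow> nat \<Rightarrow> real) \<Rightarrow> (nat \<Rightarrow> real) \<Rightarrow> (nat \<Rightarrow> real) \<Rightarrow> nat \<Rightarrow> real" where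
  "threshold_value d w x z K =
     wdiff w K * x 1 + (\<Sum>k=1..K. w k 2 * z k) + (\<Sum>k=K+1..d. (w k 1 - wdiff w K) * z k)"

text \<open>Here \<open>w k i j\<close> is $w^k_{i,j}$, so \<open>\<lambda>k. w k i\<close> collects the weights of the \<open>i\<close>-th block.\<close>

definition alpha_constraint ::
    "nat \<Rightarrow> nat \<Rightarrow> (nat \<Rightarrow> nat \<Rightarrow> nat \<Rightarrow> real) \<Rightarrow> (nat \<Rightarrow> real) \<Rightarrow> (nat \<Rightarrow> nat \<Rightarrow> real) \<Rightarrow>
     (nat \<Rightarrow> nat \<Rightarrow> real) \<times> real \<times> (nat \<Rightarrow> real) \<Rightarrow> bool" where
  "alpha_constraint \<tau> d w b \<alpha> = (\<lambda>(x, y, z).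
     y \<le> dot \<tau> \<alpha> x +
       (\<Sum>k=1..d. ((GREATEST v. \<exists>x'\<in>simplex2_power \<tau>. v = dot \<tau> (\<lambda>i j. w k i j - \<alpha> i j) x') + b k) * z k))"

definition mapping_constraint ::
    "nat \<Rightarrow> nat \<Rightarrow> (nat \<Rightarrow> nat \<Rightarrow> nat \<Rightarrow> real) \<Rightarrow> (nat \<Rightarrow> real) \<Rightarrow> (nat \<Rightarrow> nat \<Rightarrow> nat) \<Rightarrow> (nat \<Rightarrow> nat) \<Rightarrow>
     (nat \<Rightarrow> nat \<Rightarrow> real) \<times> real \<times> (nat \<Rightarrow> real) \<Rightarrow> bool" where
  "mapping_constraint \<tau> d w b \<sigma> K = (\<lambda>(x, y, z).
     y \<le> (\<Sum>i=1..\<tau>.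
            wdiff (\<lambda>k. w k i) (\<sigma> i (K i)) * x i 1
            + (\<Sum>k=1..K i. w (\<sigma> i k) i 2 * z (\<sigma> i k))
            + (\<Sum>k=K i + 1..d. (w (\<sigma> i k) i 1 - wdiff (\<lambda>k. w k i) (\<sigma> i (K i))) * z (\<sigma> i k)))
         + (\<Sum>k=1..d. b k * z k))"

definition solution_set :: "'p set \<Rightarrow> 'i set \<Rightarrow> ('i \<Rightarrow> 'p \<Rightarrow> bool) \<Rightarrow> 'p set" where
  "solution_set S I C = {p \<in> S. \<forall>i\<in>I. C i p}"

text \<open>
  Removing a constraint also removes every other member of the family that cuts out the same
  subset of the ground set; coinciding constraints (from ties) would otherwise all be redundant.
\<close>

definition nonredundant :: "'p set \<Rightarrow> 'i set \<Rightarrow> ('i \<Rightarrow> 'p \<Rightarrow> bool) \<Rightarrow> 'i \<Rightarrow> bool" where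
  "nonredundant S I C i \<longleftrightarrow>
     solution_set S I C \<subset> solution_set S {j \<in> I. {p \<in> S. C j p} \<noteq> {p \<in> S. C i p}} C"

text \<open>
  A program is a fixed syntactic object working for all input sizes. Memory consists of natural
  number registers (used for sizes and indices), real registers, and real arrays. Every
  elementary operation, including each array access and each node of an expression, takes one
  unit of time.
\<close>

datatype iexp =
    IConst nat
  | IVar string
  | IAdd iexp iexp
  | ISub iexp iexp

datatype rexp =
    RConst real
  | RVar string
  | RRead string iexp
  | RAdd rexp rexp
  | RSub rexp rexp
  | RMul rexp rexp
  | RDiv rexp rexp

datatype bexp =
    ILess iexp iexp
  | RLess rexp rexp
  | Not bexp
  | And bexp bexp

datatype com =
    Skip
  | IAssign string iexp
  | RAssign string rexp
  | Write string iexp rexp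
  | Seq com com
  | If bexp com com
  | While bexp com

record state =
  ints :: "string \<Rightarrow> nat"
  reals :: "string \<Rightarrow> real"
  arrays :: "string \<Rightarrow> nat \<Rightarrow> real"

primrec ival :: "iexp \<Rightarrow> state \<Rightarrow> nat" where
  "ival (IConst n) s = n"
| "ival (IVar v) s = ints s v"
| "ival (IAdd a b) s = ival a s + ival b s"
| "ival (ISub a b) s = ival a s - ival b s"

primrec rval :: "rexp \<Rightarrow> state \<Rightarrow> real" where
  "rval (RConst c) s = c"
| "rval (RVar v) s = reals s v"
| "rval (RRead A i) s = arrays s A (ival i s)"
| "rval (RAdd a b) s = rval a s + rval b s"
| "rval (RSub a b) s = rval a s - rval b s"
| "rval (RMul a b) s = rval a s * rval b s"
| "rval (RDiv a b) s = rval a s / rval b s"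

primrec bval :: "bexp \<Rightarrow> state \<Rightarrow> bool" where
  "bval (ILess a b) s \<longleftrightarrow> ival a s < ival b s"
| "bval (RLess a b) s \<longleftrightarrow> rval a s < rval b s"
| "bval (Not b) s \<longleftrightarrow> \<not> bval b s"
| "bval (And a b) s \<longleftrightarrow> bval a s \<and> bval b s"

primrec icost :: "iexp \<Rightarrow> nat" where
  "icost (IConst n) = 1"
| "icost (IVar v) = 1"
| "icost (IAdd a b) = 1 + icost a + icost b"
| "icost (ISub a b) = 1 + icost a + icost b"

primrec rcost :: "rexp \<Rightarrow> nat" where
  "rcost (RConst c) = 1"
| "rcost (RVar v) = 1"
| "rcost (RRead A i) = 1 + icost i"
| "rcost (RAdd a b) = 1 + rcost a + rcost b"
| "rcost (RSub a b) = 1 + rcost a + rcost b"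
| "rcost (RMul a b) = 1 + rcost a + rcost b"
| "rcost (RDiv a b) = 1 + rcost a + rcost b"

primrec bcost :: "bexp \<Rightarrow> nat" where
  "bcost (ILess a b) = 1 + icost a + icost b"
| "bcost (RLess a b) = 1 + rcost a + rcost b"
| "bcost (Not b) = 1 + bcost b"
| "bcost (And a b) = 1 + bcost a + bcost b"

text \<open>\<open>runs c s t s'\<close>: started in \<open>s\<close>, the program \<open>c\<close> halts in \<open>s'\<close> after \<open>t\<close> units of time.\<close>

inductive runs :: "com \<Rightarrow> state \<Rightarrow> nat \<Rightarrow> state \<Rightarrow> bool" where
  Skip: "runs Skip s 1 s"
| IAssign: "runs (IAssign v e) s (1 + icost e) (s\<lparr>ints := (ints s)(v := ival e s)\<rparr>)"
| RAssign: "runs (RAssign v e) s (1 + rcost e) (s\<lparr>reals := (reals s)(v := rval e s)\<rparr>)"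
| Write: "runs (Write A i e) s (1 + icost i + rcost e)
            (s\<lparr>arrays := (arrays s)(A := (arrays s A)(ival i s := rval e s))\<rparr>)"
| Seq: "runs c1 s t1 s1 \<Longrightarrow> runs c2 s1 t2 s2 \<Longrightarrow> runs (Seq c1 c2) s (t1 + t2) s2"
| IfTrue: "bval b s \<Longrightarrow> runs c1 s t s' \<Longrightarrow> runs (If b c1 c2) s (1 + bcost b + t) s'"
| IfFalse: "\<not> bval b s \<Longrightarrow> runs c2 s t s' \<Longrightarrow> runs (If b c1 c2) s (1 + bcost b + t) s'"
| WhileFalse: "\<not> bval b s \<Longrightarrow> runs (While b c) s (1 + bcost b) s"
| WhileTrue: "bval b s \<Longrightarrow> runs c s t1 s1 \<Longrightarrow> runs (While b c) s1 t2 s2 \<Longrightarrow>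
    runs (While b c) s (1 + bcost b + t1 + t2) s2"

text \<open>Memory that is not part of the input may have arbitrary initial contents.\<close>

definition holds_input ::
    "state \<Rightarrow> nat \<Rightarrow> (nat \<Rightarrow> nat \<Rightarrow> real) \<Rightarrow> (nat \<Rightarrow> real) \<Rightarrow> (nat \<Rightarrow> real) \<Rightarrow> bool" where
  "holds_input s d w x z \<longleftrightarrow>
     ints s ''d'' = d \<and>
     (\<forall>k\<in>{1..d}. arrays s ''w1'' k = w k 1 \<and> arrays s ''w2'' k = w k 2 \<and> arrays s ''z'' k = z k) \<and>
     (\<forall>j\<in>{1..2}. arrays s ''x'' j = x j)"

end

theory Submission
  imports Defs
begin

text \<open>
  Writing $\beta^k_1 = t_k$ and $\beta^k_2 = z_k - t_k$, the transport problem with two sources is a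
  fractional knapsack problem: maximise $\sum_k w^k_2 z_k + \widetilde w^k t_k$ over
  $0 \le t_k \le z_k$ with $\sum_k t_k = x_1$. Its Lagrangian dual in the single multiplier
  $\lambda$ of the last equation is piecewise linear, and its breakpoints are the
  $\widetilde w^K$, at which the dual takes the threshold values. The greedy solution certifies the
  optimal breakpoint, which a scan of the suffix sums of $z$ locates.

  Since $\sum_k z_k = 1$, the constraint indexed by $\alpha$ splits over the blocks, and
  its share in block $i$ is the dual value at $\lambda = \alpha_{i,1} - \alpha_{i,2}$; this gives the
  equivalence. For non-redundancy take $z$ uniform and $x_{i,1}$ so that
  $\widetilde w^{\sigma_i(K(i))}_i$ is the unique dual minimiser in every block: then the constraint
  of $K$ is strictly tighter at this point than any constraint with other multipliers.
\<close>

section \<open>The Lagrangian dual of the two-source transport problem\<close>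

lemma sum_1_2: "(\<Sum>j=1..2::nat. f j) = f 1 + (f 2 :: real)"
  by (simp add: numeral_2_eq_2)

lemma sum_split_at:
  fixes f :: "nat \<Rightarrow> real"
  assumes "K \<le> d"
  shows "(\<Sum>k=1..d. f k) = (\<Sum>k=1..K. f k) + (\<Sum>k=K+1..d. f k)"
  using sum.ub_add_nat[of 1 K f "d - K"] assms by simp

text \<open>For nonnegative \<open>z\<close> this is the maximum over
  \<open>0 \<le> t k \<le> z k\<close> of
  \<open>l * r + (\<Sum>k=1..d. w k 2 * z k + (wdiff w k - l) * t k)\<close>, the Lagrangian that
  relaxes \<open>(\<Sum>k=1..d. t k) = r\<close>. Unlike \<open>threshold_value\<close> it makes
  sense for unsorted weights and for every real \<open>l\<close>.\<close>

definition dual_value ::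
    "nat \<Rightarrow> (nat \<Rightarrow> nat \<Rightarrow> real) \<Rightarrow> real \<Rightarrow> (nat \<Rightarrow> real) \<Rightarrow> real \<Rightarrow> real" where
  "dual_value d w r z l = l * r + (\<Sum>k=1..d. (w k 2 + max 0 (wdiff w k - l)) * z k)"

text \<open>Sorting turns the positive part into a split of the index range: it vanishes up to
  \<open>K\<close>, and beyond \<open>K\<close> it adds \<open>wdiff w k - wdiff w K\<close>, which
  turns \<open>w k 2\<close> into \<open>w k 1 - wdiff w K\<close>.\<close>

lemma threshold_value_eq_dual_value:
  assumes "mono_on {1..d} (wdiff w)" and K: "K \<in> {1..d}"
  shows "threshold_value d w x z K = dual_value d w (x 1) z (wdiff w K)"
proof -
  let ?f = "\<lambda>k. (w k 2 + max 0 (wdiff w k - wdiff w K)) * z k"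
  have "(\<Sum>k=1..K. ?f k) = (\<Sum>k=1..K. w k 2 * z k)"
    using mono_onD[OF assms(1), of _ K] K by (intro sum.cong) (auto simp: max_absorb1)
  moreover have "(\<Sum>k=K+1..d. ?f k) = (\<Sum>k=K+1..d. (w k 1 - wdiff w K) * z k)"
  proof (intro sum.cong refl)
    fix k assume "k \<in> {K+1..d}"
    then have "wdiff w K \<le> wdiff w k" using K by (intro mono_onD[OF assms(1)]) auto
    then have "w k 2 + max 0 (wdiff w k - wdiff w K) = w k 1 - wdiff w K"
      by (simp add: wdiff_def)
    then show "?f k = (w k 1 - wdiff w K) * z k" by simp
  qed
  ultimately show ?thesis
    using sum_split_at[of K d ?f] K by (simp add: dual_value_def threshold_value_def)
qed

text \<open>The dual does not see the order of the indices, so each block can be sorted by its own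
  permutation while all blocks share one \<open>z\<close>.\<close>

lemma dual_value_reindex:
  assumes "bij_betw \<pi> {1..d} {1..d}"
  shows "dual_value d (\<lambda>k. w (\<pi> k)) r (\<lambda>k. z (\<pi> k)) l = dual_value d w r z l"
  using sum.reindex_bij_betw[OF assms, of "\<lambda>k. (w k 2 + max 0 (wdiff w k - l)) * z k"]
  by (simp add: dual_value_def wdiff_def)

text \<open>The second sum is the duality gap. For \<open>0 \<le> t k \<le> z k\<close> its terms
  are nonnegative, which is weak duality; their vanishing is complementary slackness.\<close>

lemma dual_value_primal_slack:
  assumes "(\<Sum>k=1..d. t k) = r"
  shows "dual_value d w r z l = (\<Sum>k=1..d. w k 2 * z k + wdiff w k * t k)
    + (\<Sum>k=1..d. max 0 (wdiff w k - l) * z k - (wdiff w k - l) * t k)"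
  unfolding dual_value_def assms[symmetric] sum_distrib_left sum.distrib[symmetric]
  by (intro sum.cong) (auto simp: algebra_simps)

lemma slack_nonneg:
  fixes u t z :: real
  assumes "0 \<le> t" "t \<le> z"
  shows "0 \<le> max 0 u * z - u * t"
  using assms mult_left_mono[of t z u] mult_nonpos_nonneg[of u t] by (auto simp: max_def)

lemma primal_le_dual_value:
  assumes "\<And>k. k \<in> {1..d} \<Longrightarrow> 0 \<le> t k \<and> t k \<le> z k" and "(\<Sum>k=1..d. t k) = r"
  shows "(\<Sum>k=1..d. w k 2 * z k + wdiff w k * t k) \<le> dual_value d w r z l"
  unfolding dual_value_primal_slack[OF assms(2)]
  using assms(1) by (auto intro!: sum_nonneg slack_nonneg)

section \<open>Greedy solutions and the optimal threshold\<close>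

text \<open>The amount \<open>r\<close> is spent on the largest \<open>wdiff\<close> first: indices
  above \<open>K\<close> are full, those below are empty, and \<open>K\<close> takes the remainder.
  This is complementary to the multiplier \<open>wdiff w K\<close>, so the duality gap is
  zero.\<close>

lemma greedy_solution:
  assumes mono: "mono_on {1..d} (wdiff w)" and K: "K \<in> {1..d}"
    and z: "\<And>k. k \<in> {1..d} \<Longrightarrow> 0 \<le> z k"
    and r: "(\<Sum>k=K+1..d. z k) \<le> r" "r \<le> (\<Sum>k=K..d. z k)"
  obtains t where "\<And>k. k \<in> {1..d} \<Longrightarrow> 0 \<le> t k \<and> t k \<le> z k" "(\<Sum>k=1..d. t k) = r"
    "dual_value d w r z (wdiff w K) = (\<Sum>k=1..d. w k 2 * z k + wdiff w k * t k)"
proof -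
  define t where "t k = (if k < K then 0 else if k = K then r - (\<Sum>k=K+1..d. z k) else z k)" for k
  \<comment> \<open>Splitting off \<open>z K\<close> turns the two bounds on \<open>r\<close> into
    \<open>0 \<le> t K\<close> and \<open>t K \<le> z K\<close>.\<close>
  have zK: "(\<Sum>k=K..d. z k) = z K + (\<Sum>k=K+1..d. z k)"
    using K sum.atLeast_Suc_atMost[of K d z] by simp
  have bounds: "0 \<le> t k \<and> t k \<le> z k" if "k \<in> {1..d}" for k
    using r zK z[OF that] by (auto simp: t_def)
  have "(\<Sum>k=1..K. t k) = (\<Sum>k=1..K. if k = K then r - (\<Sum>k=K+1..d. z k) else 0)"
    by (intro sum.cong) (auto simp: t_def)
  also have "\<dots> = r - (\<Sum>k=K+1..d. z k)" using K by (subst sum.delta) auto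
  finally have "(\<Sum>k=1..K. t k) = r - (\<Sum>k=K+1..d. z k)" .
  moreover have "(\<Sum>k=K+1..d. t k) = (\<Sum>k=K+1..d. z k)"
    by (intro sum.cong) (auto simp: t_def)
  ultimately have sum_t: "(\<Sum>k=1..d. t k) = r"
    using sum_split_at[of K d t] K by simp
  have "(\<Sum>k=1..d. max 0 (wdiff w k - wdiff w K) * z k - (wdiff w k - wdiff w K) * t k) = 0"
  proof (intro sum.neutral ballI)
    fix k assume k: "k \<in> {1..d}"
    show "max 0 (wdiff w k - wdiff w K) * z k - (wdiff w k - wdiff w K) * t k = 0"
      using mono_onD[OF mono k K] mono_onD[OF mono K k]
      by (cases k K rule: linorder_cases) (auto simp: t_def max_absorb1 max_absorb2)
  qed
  then show thesis
    using that[OF bounds sum_t] dual_value_primal_slack[OF sum_t, of w z "wdiff w K"] by simp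
qed

text \<open>Take the least positive index whose strict suffix sum is at most \<open>r\<close>;
  \<open>d\<close> qualifies because its strict suffix is empty. Minimality at \<open>K - 1\<close>,
  whose strict suffix starts at \<open>K\<close>, gives the other bound, and for
  \<open>K = 1\<close> that bound is the one on the total.\<close>

lemma threshold_exists:
  fixes z :: "nat \<Rightarrow> real"
  assumes "1 \<le> d" "0 \<le> r" "r \<le> (\<Sum>k=1..d. z k)"
  obtains K where "K \<in> {1..d}" "(\<Sum>k=K+1..d. z k) \<le> r" "r \<le> (\<Sum>k=K..d. z k)"
proof -
  define P where "P K \<longleftrightarrow> 1 \<le> K \<and> (\<Sum>k=K+1..d. z k) \<le> r" for K
  have "P d" using assms by (simp add: P_def)
  then obtain K where K: "P K" "\<And>m. m < K \<Longrightarrow> \<not> P m" "K \<le> d"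
    using LeastI[of P d] not_less_Least[of _ P] Least_le[of P d] by blast
  have "r \<le> (\<Sum>k=K..d. z k)"
  proof (cases "K = 1")
    case True then show ?thesis using assms(3) by simp
  next
    case False
    then have "1 \<le> K - 1" "K - 1 < K" using K(1) by (auto simp: P_def)
    then show ?thesis using K(2)[of "K - 1"] by (simp add: P_def)
  qed
  then show thesis using that[of K] K(1,3) by (simp add: P_def)
qed

lemma std_simplex_nonneg: "v \<in> std_simplex n \<Longrightarrow> k \<in> {1..n} \<Longrightarrow> 0 \<le> v k"
  by (auto simp: std_simplex_def PiE_def Pi_def)

lemma std_simplex_sum: "v \<in> std_simplex n \<Longrightarrow> (\<Sum>k=1..n. v k) = 1"
  by (simp add: std_simplex_def)

lemma std_simplex_2D:
  assumes "x \<in> std_simplex 2"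
  shows "0 \<le> x 1" "0 \<le> x 2" "x 1 + x 2 = 1"
  using std_simplex_nonneg[OF assms, of 1] std_simplex_nonneg[OF assms, of 2]
    std_simplex_sum[OF assms] by (auto simp: sum_1_2 simp del: One_nat_def)

text \<open>The greedy solution attains the dual value and weak duality bounds every feasible plan
  by it, so \<open>GREATEST\<close> picks out this value.\<close>

lemma transport_eq_dual_value:
  assumes mono: "mono_on {1..d} (wdiff w)" and x: "x \<in> std_simplex 2" and z: "z \<in> std_simplex d"
    and K: "K \<in> {1..d}" "(\<Sum>k=K+1..d. z k) \<le> x 1" "x 1 \<le> (\<Sum>k=K..d. z k)"
  shows "transport 2 d x z w = dual_value d w (x 1) z (wdiff w K)"
  unfolding transport_def
proof (rule Greatest_equality)
  obtain t where t: "\<And>k. k \<in> {1..d} \<Longrightarrow> 0 \<le> t k \<and> t k \<le> z k" "(\<Sum>k=1..d. t k) = x 1"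
    and dual: "dual_value d w (x 1) z (wdiff w K) = (\<Sum>k=1..d. w k 2 * z k + wdiff w k * t k)"
    using greedy_solution[OF mono K(1) std_simplex_nonneg[OF z] K(2,3)] by blast
  define \<beta> where "\<beta> k j = (if j = 1 then t k else z k - t k)" for k and j :: nat
  have "transport_feasible 2 d x z \<beta>"
    unfolding transport_feasible_def
  proof (intro conjI ballI)
    fix j :: nat assume "j \<in> {1..2}"
    then have "j = 1 \<or> j = 2" by auto
    then show "(\<Sum>k=1..d. \<beta> k j) = x j"
      using t(2) std_simplex_sum[OF z] std_simplex_2D[OF x] by (auto simp: \<beta>_def sum_subtractf)
  qed (use t(1) in \<open>auto simp: \<beta>_def sum_1_2 simp del: One_nat_def\<close>)
  moreover have "dual_value d w (x 1) z (wdiff w K) = (\<Sum>k=1..d. \<Sum>j=1..2. w k j * \<beta> k j)"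
    unfolding dual sum_1_2 by (intro sum.cong) (auto simp: \<beta>_def wdiff_def algebra_simps)
  ultimately show "\<exists>\<beta>. transport_feasible 2 d x z \<beta> \<and>
      dual_value d w (x 1) z (wdiff w K) = (\<Sum>k=1..d. \<Sum>j=1..2. w k j * \<beta> k j)" by blast
next
  fix v assume "\<exists>\<beta>. transport_feasible 2 d x z \<beta> \<and> v = (\<Sum>k=1..d. \<Sum>j=1..2. w k j * \<beta> k j)"
  then obtain \<beta> where \<beta>: "transport_feasible 2 d x z \<beta>"
    and v: "v = (\<Sum>k=1..d. \<Sum>j=1..2. w k j * \<beta> k j)" by blast
  have z_eq: "z k = \<beta> k 1 + \<beta> k 2" if "k \<in> {1..d}" for k
    using \<beta> that by (auto simp: transport_feasible_def sum_1_2 simp del: One_nat_def)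
  have nonneg: "0 \<le> \<beta> k 1" "0 \<le> \<beta> k 2" if "k \<in> {1..d}" for k
    using \<beta> that by (auto simp: transport_feasible_def)
  have "v = (\<Sum>k=1..d. w k 2 * z k + wdiff w k * \<beta> k 1)"
    unfolding v sum_1_2 by (intro sum.cong) (auto simp: z_eq wdiff_def algebra_simps)
  also have "\<dots> \<le> dual_value d w (x 1) z (wdiff w K)"
    using \<beta> nonneg z_eq by (intro primal_le_dual_value) (auto simp: transport_feasible_def)
  finally show "v \<le> dual_value d w (x 1) z (wdiff w K)" .
qed

text \<open>The left side is the value of a feasible greedy solution, hence below every dual value.
  That \<open>l\<close> ranges over all reals, not only over the breakpoints, is what the comparison
  with arbitrary \<alpha> requires.\<close>

lemma threshold_optimal:
  assumes "mono_on {1..d} (wdiff w)" "z \<in> std_simplex d"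
    and "K \<in> {1..d}" "(\<Sum>k=K+1..d. z k) \<le> r" "r \<le> (\<Sum>k=K..d. z k)"
  shows "dual_value d w r z (wdiff w K) \<le> dual_value d w r z l"
proof -
  obtain t where "\<And>k. k \<in> {1..d} \<Longrightarrow> 0 \<le> t k \<and> t k \<le> z k" "(\<Sum>k=1..d. t k) = r"
    and dual: "dual_value d w r z (wdiff w K) = (\<Sum>k=1..d. w k 2 * z k + wdiff w k * t k)"
    using greedy_solution[OF assms(1,3) std_simplex_nonneg[OF assms(2)] assms(4,5)] by blast
  then show ?thesis unfolding dual by (intro primal_le_dual_value)
qed

lemma threshold_value_eq_Min:
  assumes mono: "mono_on {1..d} (wdiff w)" and z: "z \<in> std_simplex d"
    and K: "K \<in> {1..d}" "(\<Sum>k=K+1..d. z k) \<le> x 1" "x 1 \<le> (\<Sum>k=K..d. z k)"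
  shows "threshold_value d w x z K = (MIN K\<in>{1..d}. threshold_value d w x z K)"
proof (rule sym, rule Min_eqI)
  fix y assume "y \<in> threshold_value d w x z ` {1..d}"
  then show "threshold_value d w x z K \<le> y"
    using threshold_optimal[OF mono z K] threshold_value_eq_dual_value[OF mono] K(1) by auto
qed (use K in auto)

lemma transport_eq_Min:
  assumes "1 \<le> d" and mono: "mono_on {1..d} (wdiff w)"
    and x: "x \<in> std_simplex 2" and z: "z \<in> std_simplex d"
  shows "transport 2 d x z w = (MIN K\<in>{1..d}. threshold_value d w x z K)"
proof -
  obtain K where K: "K \<in> {1..d}" "(\<Sum>k=K+1..d. z k) \<le> x 1" "x 1 \<le> (\<Sum>k=K..d. z k)"
    using threshold_exists[of d "x 1" z] assms std_simplex_2D[OF x] std_simplex_sum[OF z]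
    by (metis add_increasing2 order_refl)
  show ?thesis
    using transport_eq_dual_value[OF mono x z K] threshold_value_eq_Min[where x=x, OF mono z K]
      threshold_value_eq_dual_value[OF mono K(1), of x z] by simp
qed

section \<open>Linear-time search for the optimal threshold\<close>

definition scan_guard :: bexp where
  "scan_guard = And (RLess (RVar ''S'') (RRead ''x'' (IConst 1))) (ILess (IConst 1) (IVar ''K''))"

definition scan_body :: com where
  "scan_body = Seq (IAssign ''K'' (ISub (IVar ''K'') (IConst 1)))
     (RAssign ''S'' (RAdd (RVar ''S'') (RRead ''z'' (IVar ''K''))))"

text \<open>\<open>S\<close> holds the sum of \<open>z\<close> over \<open>{K..d}\<close>, and
  \<open>K\<close> descends from \<open>d\<close> until \<open>S\<close> reaches \<open>x 1\<close>.
  The weights are never read: once they are sorted, \<open>x\<close> and \<open>z\<close> determine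
  an optimal index.\<close>

definition scan :: com where
  "scan = Seq (IAssign ''K'' (IVar ''d''))
     (Seq (RAssign ''S'' (RRead ''z'' (IVar ''K''))) (While scan_guard scan_body))"

text \<open>The decrement takes 4 units and the addition 5; the addition reads \<open>z\<close> at
  the already decremented index.\<close>

lemma scan_body_runs:
  "runs scan_body s 9 (s\<lparr>ints := (ints s)(''K'' := ints s ''K'' - 1),
     reals := (reals s)(''S'' := reals s ''S'' + arrays s ''z'' (ints s ''K'' - 1))\<rparr>)"
proof -
  let ?s = "s\<lparr>ints := (ints s)(''K'' := ival (ISub (IVar ''K'') (IConst 1)) s)\<rparr>"
  show ?thesis
    using runs.Seq[OF runs.IAssign[of "''K''" "ISub (IVar ''K'') (IConst 1)" s]
        runs.RAssign[of "''S''" "RAdd (RVar ''S'') (RRead ''z'' (IVar ''K''))" ?s]]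
    by (simp add: scan_body_def eval_nat_numeral)
qed

text \<open>The assumptions are the loop invariant, and the induction is on the current
  \<open>K\<close>. A full round costs 9 units for the test and 9 for the body; the last, failing
  test costs 9, which fits because \<open>K\<close> is still at least 1.\<close>

lemma scan_loop_runs:
  assumes "ints s ''K'' \<in> {1..d}" "reals s ''S'' = (\<Sum>k=ints s ''K''..d. arrays s ''z'' k)"
    and "(\<Sum>k=ints s ''K''+1..d. arrays s ''z'' k) \<le> arrays s ''x'' 1"
    and "arrays s ''x'' 1 \<le> (\<Sum>k=1..d. arrays s ''z'' k)"
  shows "\<exists>t s'. runs (While scan_guard scan_body) s t s' \<and> t \<le> 18 * ints s ''K'' \<and>
    ints s' ''K'' \<in> {1..d} \<and>
    (\<Sum>k=ints s' ''K''+1..d. arrays s ''z'' k) \<le> arrays s ''x'' 1 \<and>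
    arrays s ''x'' 1 \<le> (\<Sum>k=ints s' ''K''..d. arrays s ''z'' k)"
  using assms
proof (induction "ints s ''K''" arbitrary: s)
  case 0
  then show ?case by simp
next
  case (Suc n)
  have cost: "bcost scan_guard = 8" by (simp add: scan_guard_def)
  show ?case
  proof (cases "bval scan_guard s")
    case False
    \<comment> \<open>The test fails because \<open>S\<close> has reached \<open>x 1\<close> or
      because \<open>K = 1\<close>; in the latter case the suffix is the whole range.\<close>
    then have "arrays s ''x'' 1 \<le> (\<Sum>k=ints s ''K''..d. arrays s ''z'' k)"
      using Suc by (cases "ints s ''K'' = 1") (auto simp: scan_guard_def)
    then show ?thesis
      using runs.WhileFalse[OF False, of scan_body] Suc cost
      by (intro exI[of _ "1 + bcost scan_guard"] exI[of _ s]) auto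
  next
    case True
    let ?s = "s\<lparr>ints := (ints s)(''K'' := ints s ''K'' - 1),
      reals := (reals s)(''S'' := reals s ''S'' + arrays s ''z'' (ints s ''K'' - 1))\<rparr>"
    have n: "1 \<le> n" "n \<le> d" "reals s ''S'' < arrays s ''x'' 1"
      using True Suc.hyps(2) Suc.prems(1) by (auto simp: scan_guard_def)
    \<comment> \<open>The new \<open>S\<close> is the suffix sum from \<open>n\<close>. The old
      \<open>S\<close>, which the guard puts below \<open>x 1\<close>, is the strict suffix sum of
      \<open>n\<close>, so the invariant is preserved.\<close>
    have "(\<Sum>k=n..d. arrays s ''z'' k) = arrays s ''z'' n + (\<Sum>k=n+1..d. arrays s ''z'' k)"
      using n sum.atLeast_Suc_atMost[of n d "arrays s ''z''"] by simp
    then have "\<exists>t s'. runs (While scan_guard scan_body) ?s t s' \<and> t \<le> 18 * ints ?s ''K'' \<and>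
        ints s' ''K'' \<in> {1..d} \<and>
        (\<Sum>k=ints s' ''K''+1..d. arrays ?s ''z'' k) \<le> arrays ?s ''x'' 1 \<and>
        arrays ?s ''x'' 1 \<le> (\<Sum>k=ints s' ''K''..d. arrays ?s ''z'' k)"
      using n Suc.prems Suc.hyps(2)[symmetric] by (intro Suc.hyps(1)) auto
    then obtain t s' where *: "runs (While scan_guard scan_body) ?s t s'" "t \<le> 18 * n"
        "ints s' ''K'' \<in> {1..d}"
        "(\<Sum>k=ints s' ''K''+1..d. arrays s ''z'' k) \<le> arrays s ''x'' 1"
        "arrays s ''x'' 1 \<le> (\<Sum>k=ints s' ''K''..d. arrays s ''z'' k)"
      using Suc.hyps(2)[symmetric] by auto
    then show ?thesis
      using runs.WhileTrue[OF True scan_body_runs *(1)] Suc.hyps(2)[symmetric] cost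
      by (intro exI[of _ "1 + bcost scan_guard + 9 + t"] exI[of _ s']) auto
  qed
qed

lemma scan_correct:
  assumes "1 \<le> d" and mono: "mono_on {1..d} (wdiff w)"
    and x: "x \<in> std_simplex 2" and z: "z \<in> std_simplex d" and s: "holds_input s d w x z"
  shows "\<exists>t s'. runs scan s t s' \<and> t \<le> 18 * d + 5 \<and> ints s' ''K'' \<in> {1..d} \<and>
    threshold_value d w x z (ints s' ''K'') = (MIN K\<in>{1..d}. threshold_value d w x z K)"
proof -
  define s1 where "s1 = s\<lparr>ints := (ints s)(''K'' := d)\<rparr>"
  define s2 where "s2 = s1\<lparr>reals := (reals s1)(''S'' := arrays s ''z'' d)\<rparr>"
  have zs: "arrays s ''z'' k = z k" if "k \<in> {1..d}" for k
    using s that by (auto simp: holds_input_def)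
  have d: "ints s ''d'' = d" and x1: "arrays s ''x'' 1 = x 1"
    using s by (auto simp: holds_input_def)
  have sums: "(\<Sum>k=m..d. arrays s ''z'' k) = (\<Sum>k=m..d. z k)" if "1 \<le> m" for m
    using that by (intro sum.cong) (auto simp: zs)
  have r1: "runs (IAssign ''K'' (IVar ''d'')) s 2 s1"
    using runs.IAssign[of "''K''" "IVar ''d''" s] by (simp add: s1_def d eval_nat_numeral)
  have r2: "runs (RAssign ''S'' (RRead ''z'' (IVar ''K''))) s1 3 s2"
    using runs.RAssign[of "''S''" "RRead ''z'' (IVar ''K'')" s1] by (simp add: s1_def s2_def eval_nat_numeral)
  \<comment> \<open>At \<open>K = d\<close> the suffix is the single entry \<open>z d\<close> and
    the strict suffix is empty, so the invariant holds initially.\<close>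
  have "\<exists>t s'. runs (While scan_guard scan_body) s2 t s' \<and> t \<le> 18 * ints s2 ''K'' \<and>
    ints s' ''K'' \<in> {1..d} \<and>
    (\<Sum>k=ints s' ''K''+1..d. arrays s2 ''z'' k) \<le> arrays s2 ''x'' 1 \<and>
    arrays s2 ''x'' 1 \<le> (\<Sum>k=ints s' ''K''..d. arrays s2 ''z'' k)"
    using assms(1) x1 sums[of 1] std_simplex_2D[OF x] std_simplex_sum[OF z]
    by (intro scan_loop_runs) (auto simp: s1_def s2_def)
  then obtain t s' where r3: "runs (While scan_guard scan_body) s2 t s'" and "t \<le> 18 * d"
    and K: "ints s' ''K'' \<in> {1..d}"
    and le: "(\<Sum>k=ints s' ''K''+1..d. z k) \<le> x 1" "x 1 \<le> (\<Sum>k=ints s' ''K''..d. z k)"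
    using sums x1 by (auto simp: s1_def s2_def)
  then have "2 + (3 + t) \<le> 18 * d + 5" by simp
  moreover have "runs scan s (2 + (3 + t)) s'"
    unfolding scan_def by (rule runs.Seq[OF r1 runs.Seq[OF r2 r3]])
  ultimately show ?thesis
    using threshold_value_eq_Min[where x=x, OF mono z K le] K by blast
qed

section \<open>Splitting the constraint families over the blocks\<close>

lemma simplex2_power_block: "x \<in> simplex2_power \<tau> \<Longrightarrow> i \<in> {1..\<tau>} \<Longrightarrow> x i \<in> std_simplex 2"
  by (auto simp: simplex2_power_def)

lemma std_simplex_2I:
  assumes "0 \<le> r" "r \<le> 1"
  shows "(\<lambda>j\<in>{1..2}. if j = 1 then r else 1 - r) \<in> std_simplex 2"
  using assms by (auto simp: std_simplex_def sum_1_2 simp del: One_nat_def)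

lemma Greatest_dot_simplex2_power:
  \<comment> \<open>Placed inside the proof's statement, the value arises because the objective
    separates over the blocks and a linear function on a segment is maximal at an endpoint.\<close>
  "(GREATEST v. \<exists>x\<in>simplex2_power \<tau>. v = dot \<tau> c x) = (\<Sum>i=1..\<tau>. max (c i 1) (c i 2))"
proof (rule Greatest_equality)
  define x where "x = (\<lambda>i\<in>{1..\<tau>}. \<lambda>j\<in>{1..2::nat}.
    if j = 1 then if c i 2 \<le> c i 1 then 1 else 0 else 1 - (if c i 2 \<le> c i 1 then 1 else (0::real)))"
  have "x \<in> simplex2_power \<tau>"
    unfolding simplex2_power_def x_def by (intro restrict_PiE_iff[THEN iffD2] ballI std_simplex_2I) auto
  moreover have "(\<Sum>i=1..\<tau>. max (c i 1) (c i 2)) = dot \<tau> c x"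
    unfolding dot_def sum_1_2 by (intro sum.cong) (auto simp: x_def max_def)
  ultimately show "\<exists>x\<in>simplex2_power \<tau>. (\<Sum>i=1..\<tau>. max (c i 1) (c i 2)) = dot \<tau> c x" by blast
next
  fix v assume "\<exists>x\<in>simplex2_power \<tau>. v = dot \<tau> c x"
  then obtain x where x: "x \<in> simplex2_power \<tau>" and v: "v = dot \<tau> c x" by blast
  show "v \<le> (\<Sum>i=1..\<tau>. max (c i 1) (c i 2))"
    unfolding v dot_def sum_1_2
  proof (rule sum_mono)
    fix i assume "i \<in> {1..\<tau>}"
    note xi = std_simplex_2D[OF simplex2_power_block[OF x this]]
    have "c i 1 * x i 1 + c i 2 * x i 2 \<le> max (c i 1) (c i 2) * x i 1 + max (c i 1) (c i 2) * x i 2"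
      using xi by (intro add_mono mult_right_mono) auto
    also have "\<dots> = max (c i 1) (c i 2)" using xi by (simp flip: distrib_left)
    finally show "c i 1 * x i 1 + c i 2 * x i 2 \<le> max (c i 1) (c i 2)" .
  qed
qed

text \<open>Each block of \<open>x\<close> and the vector \<open>z\<close> sum to 1, so shifting
  \<open>\<alpha> i 1\<close> and \<open>\<alpha> i 2\<close> by a common constant changes nothing.
  Only their difference survives, as the multiplier of block \<open>i\<close>.\<close>

lemma alpha_constraint_iff_dual_value:
  assumes x: "x \<in> simplex2_power \<tau>" and z: "z \<in> std_simplex d"
  shows "alpha_constraint \<tau> d w b \<alpha> (x, y, z) \<longleftrightarrow>
    y \<le> (\<Sum>i=1..\<tau>. dual_value d (\<lambda>k. w k i) (x i 1) z (\<alpha> i 1 - \<alpha> i 2)) + (\<Sum>k=1..d. b k * z k)"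
proof -
  have "(\<Sum>i=1..\<tau>. dual_value d (\<lambda>k. w k i) (x i 1) z (\<alpha> i 1 - \<alpha> i 2)) =
    (\<Sum>i=1..\<tau>. (\<alpha> i 1 * x i 1 + \<alpha> i 2 * x i 2)
      + (\<Sum>k=1..d. max (w k i 1 - \<alpha> i 1) (w k i 2 - \<alpha> i 2) * z k))"
  proof (intro sum.cong refl)
    fix i assume "i \<in> {1..\<tau>}"
    note xi = std_simplex_2D[OF simplex2_power_block[OF x this]]
    \<comment> \<open>The extracted \<open>- \<alpha> i 2\<close>, summed against \<open>z\<close>,
      cancels \<open>\<alpha> i 2 * (x i 1 + x i 2)\<close>.\<close>
    have "max (w k i 1 - \<alpha> i 1) (w k i 2 - \<alpha> i 2) =
        w k i 2 + max 0 (wdiff (\<lambda>k. w k i) k - (\<alpha> i 1 - \<alpha> i 2)) - \<alpha> i 2" for k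
      by (auto simp: wdiff_def max_def)
    then have "(\<Sum>k=1..d. max (w k i 1 - \<alpha> i 1) (w k i 2 - \<alpha> i 2) * z k) =
        (\<Sum>k=1..d. (w k i 2 + max 0 (wdiff (\<lambda>k. w k i) k - (\<alpha> i 1 - \<alpha> i 2))) * z k) - \<alpha> i 2"
      using std_simplex_sum[OF z] by (simp add: left_diff_distrib sum_subtractf flip: sum_distrib_left)
    moreover have "\<alpha> i 1 * x i 1 + \<alpha> i 2 * x i 2 = (\<alpha> i 1 - \<alpha> i 2) * x i 1 + \<alpha> i 2 * (x i 1 + x i 2)"
      by (simp add: algebra_simps)
    ultimately show "dual_value d (\<lambda>k. w k i) (x i 1) z (\<alpha> i 1 - \<alpha> i 2) =
      (\<alpha> i 1 * x i 1 + \<alpha> i 2 * x i 2)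
      + (\<Sum>k=1..d. max (w k i 1 - \<alpha> i 1) (w k i 2 - \<alpha> i 2) * z k)"
      using xi by (simp add: dual_value_def)
  qed
  also have "\<dots> = dot \<tau> \<alpha> x
      + (\<Sum>k=1..d. (\<Sum>i=1..\<tau>. max (w k i 1 - \<alpha> i 1) (w k i 2 - \<alpha> i 2)) * z k)"
    unfolding sum.distrib dot_def sum_1_2 sum_distrib_right by (intro arg_cong2[where f = "(+)"] refl sum.swap)
  finally show ?thesis
    by (simp add: alpha_constraint_def Greatest_dot_simplex2_power distrib_right sum.distrib
      add.assoc)
qed

text \<open>Each block is a threshold value for data sorted by \<open>\<sigma> i\<close>. In dual
  form the permutation remains only in the choice of the multiplier.\<close>

lemma mapping_constraint_iff_dual_value:
  assumes \<sigma>: "\<forall>i\<in>{1..\<tau>}. bij_betw (\<sigma> i) {1..d} {1..d}"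
    and mono: "\<forall>i\<in>{1..\<tau>}. mono_on {1..d} (\<lambda>k. wdiff (\<lambda>k. w k i) (\<sigma> i k))"
    and K: "K \<in> {1..\<tau>} \<rightarrow>\<^sub>E {1..d}"
  shows "mapping_constraint \<tau> d w b \<sigma> K (x, y, z) \<longleftrightarrow>
    y \<le> (\<Sum>i=1..\<tau>. dual_value d (\<lambda>k. w k i) (x i 1) z (wdiff (\<lambda>k. w k i) (\<sigma> i (K i))))
      + (\<Sum>k=1..d. b k * z k)"
proof -
  have "threshold_value d (\<lambda>k. w (\<sigma> i k) i) (x i) (\<lambda>k. z (\<sigma> i k)) (K i) =
      dual_value d (\<lambda>k. w k i) (x i 1) z (wdiff (\<lambda>k. w k i) (\<sigma> i (K i)))" if i: "i \<in> {1..\<tau>}" for i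
  proof -
    have "wdiff (\<lambda>k. w (\<sigma> i k) i) = (\<lambda>k. wdiff (\<lambda>k. w k i) (\<sigma> i k))"
      by (simp add: wdiff_def fun_eq_iff)
    then show ?thesis
      using threshold_value_eq_dual_value[of d "\<lambda>k. w (\<sigma> i k) i" "K i"] bspec[OF mono i] PiE_mem[OF K i]
        dual_value_reindex[OF bspec[OF \<sigma> i], of "\<lambda>k. w k i"] by simp
  qed
  then have "(\<Sum>i=1..\<tau>. threshold_value d (\<lambda>k. w (\<sigma> i k) i) (x i) (\<lambda>k. z (\<sigma> i k)) (K i)) =
      (\<Sum>i=1..\<tau>. dual_value d (\<lambda>k. w k i) (x i 1) z (wdiff (\<lambda>k. w k i) (\<sigma> i (K i))))"
    by (intro sum.cong) auto
  then show ?thesis by (simp add: mapping_constraint_def threshold_value_def wdiff_def)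
qed

text \<open>A mapping constraint is the constraint of an \<alpha> whose block differences are the
  chosen breakpoints. Conversely, each block has a breakpoint minimising its dual over all
  multipliers. As \<open>K\<close> chooses independently in each block, these form one mapping,
  whose constraint implies all others at the given point.\<close>

lemma alpha_constraints_iff_mapping_constraints:
  assumes "1 \<le> d"
    and \<sigma>: "\<forall>i\<in>{1..\<tau>}. bij_betw (\<sigma> i) {1..d} {1..d}"
    and mono: "\<forall>i\<in>{1..\<tau>}. mono_on {1..d} (\<lambda>k. wdiff (\<lambda>k. w k i) (\<sigma> i k))"
    and x: "x \<in> simplex2_power \<tau>" and z: "z \<in> std_simplex d"
  shows "(\<forall>\<alpha>. alpha_constraint \<tau> d w b \<alpha> (x, y, z)) \<longleftrightarrow>
    (\<forall>K\<in>{1..\<tau>} \<rightarrow>\<^sub>E {1..d}. mapping_constraint \<tau> d w b \<sigma> K (x, y, z))"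
proof (intro iffI ballI allI)
  fix K assume \<alpha>: "\<forall>\<alpha>. alpha_constraint \<tau> d w b \<alpha> (x, y, z)" and K: "K \<in> {1..\<tau>} \<rightarrow>\<^sub>E {1..d}"
  show "mapping_constraint \<tau> d w b \<sigma> K (x, y, z)"
    using \<alpha>[THEN spec, of "\<lambda>i j. if j = 1 then wdiff (\<lambda>k. w k i) (\<sigma> i (K i)) else 0"]
    by (simp add: alpha_constraint_iff_dual_value[OF x z] mapping_constraint_iff_dual_value[OF \<sigma> mono K])
next
  fix \<alpha> :: "nat \<Rightarrow> nat \<Rightarrow> real"
  assume maps: "\<forall>K\<in>{1..\<tau>} \<rightarrow>\<^sub>E {1..d}. mapping_constraint \<tau> d w b \<sigma> K (x, y, z)"
  have "\<exists>k\<in>{1..d}. \<forall>l. dual_value d (\<lambda>k. w k i) (x i 1) z (wdiff (\<lambda>k. w k i) (\<sigma> i k)) \<le>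
      dual_value d (\<lambda>k. w k i) (x i 1) z l" if i: "i \<in> {1..\<tau>}" for i
  proof -
    \<comment> \<open>The restriction makes the permuted \<open>z\<close> extensional, as membership
      in \<open>std_simplex\<close> demands.\<close>
    let ?w = "\<lambda>k. w (\<sigma> i k) i" and ?z = "\<lambda>k\<in>{1..d}. z (\<sigma> i k)"
    have wdiff: "wdiff ?w = (\<lambda>k. wdiff (\<lambda>k. w k i) (\<sigma> i k))" by (simp add: wdiff_def fun_eq_iff)
    have mono': "mono_on {1..d} (wdiff ?w)" using bspec[OF mono i] by (simp add: wdiff)
    have "z (\<sigma> i k) \<ge> 0" if "k \<in> {1..d}" for k
      using std_simplex_nonneg[OF z] bij_betwE[OF bspec[OF \<sigma> i]] that by blast
    moreover have "(\<Sum>k=1..d. z (\<sigma> i k)) = 1"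
      using sum.reindex_bij_betw[OF bspec[OF \<sigma> i], of z] std_simplex_sum[OF z] by simp
    ultimately have z': "?z \<in> std_simplex d" by (auto simp: std_simplex_def)
    have dual: "dual_value d ?w r ?z l = dual_value d (\<lambda>k. w k i) r z l" for r l
      using dual_value_reindex[OF bspec[OF \<sigma> i], of "\<lambda>k. w k i" r z l] by (simp add: dual_value_def)
    obtain k where k: "k \<in> {1..d}" "(\<Sum>k=k+1..d. ?z k) \<le> x i 1" "x i 1 \<le> (\<Sum>k=k..d. ?z k)"
      using threshold_exists[of d "x i 1" ?z] \<open>1 \<le> d\<close> std_simplex_sum[OF z']
        std_simplex_2D[OF simplex2_power_block[OF x i]] by (metis add_increasing2 order_refl)
    show ?thesis using threshold_optimal[OF mono' z' k] unfolding dual wdiff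
      by (intro bexI[OF _ k(1)] allI)
  qed
  then obtain K where K: "\<And>i. i \<in> {1..\<tau>} \<Longrightarrow> K i \<in> {1..d}"
    "\<And>i l. i \<in> {1..\<tau>} \<Longrightarrow> dual_value d (\<lambda>k. w k i) (x i 1) z (wdiff (\<lambda>k. w k i) (\<sigma> i (K i))) \<le>
      dual_value d (\<lambda>k. w k i) (x i 1) z l" by metis
  have K': "restrict K {1..\<tau>} \<in> {1..\<tau>} \<rightarrow>\<^sub>E {1..d}" using K(1) by auto
  have "y \<le> (\<Sum>i=1..\<tau>. dual_value d (\<lambda>k. w k i) (x i 1) z (wdiff (\<lambda>k. w k i) (\<sigma> i (K i))))
      + (\<Sum>k=1..d. b k * z k)"
    using bspec[OF maps K'] mapping_constraint_iff_dual_value[OF \<sigma> mono K'] by simp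
  also have "\<dots> \<le> (\<Sum>i=1..\<tau>. dual_value d (\<lambda>k. w k i) (x i 1) z (\<alpha> i 1 - \<alpha> i 2))
      + (\<Sum>k=1..d. b k * z k)"
    by (intro add_right_mono sum_mono K(2))
  finally show "alpha_constraint \<tau> d w b \<alpha> (x, y, z)"
    by (simp add: alpha_constraint_iff_dual_value[OF x z])
qed

section \<open>Unique dual minimisers and non-redundancy\<close>

text \<open>
  The witness splits the mass at the ties \<open>wdiff w k = wdiff w m\<close> in half, which makes both
  one-sided slopes of the dual at \<open>wdiff w m\<close> nonzero.
\<close>

lemma unique_dual_minimiser:
  assumes z: "\<And>k. k \<in> {1..d} \<Longrightarrow> 0 < z k" and "(\<Sum>k=1..d. z k) = 1" and m: "m \<in> {1..d}"
  obtains r where "0 \<le> r" "r \<le> 1"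
    "\<And>l. l \<noteq> wdiff w m \<Longrightarrow> dual_value d w r z (wdiff w m) < dual_value d w r z l"
proof -
  define t where "t k = (if wdiff w m < wdiff w k then z k
    else if wdiff w k = wdiff w m then z k / 2 else 0)" for k
  have t: "0 \<le> t k" "t k \<le> z k" if "k \<in> {1..d}" for k
    using z[OF that] by (auto simp: t_def)
  have "(\<Sum>k=1..d. t k) \<le> 1" using sum_mono[of "{1..d}" t z] t(2) assms(2) by simp
  moreover have "0 \<le> (\<Sum>k=1..d. t k)" using t(1) by (intro sum_nonneg)
  moreover have "dual_value d w (\<Sum>k=1..d. t k) z (wdiff w m) < dual_value d w (\<Sum>k=1..d. t k) z l"
    if l: "l \<noteq> wdiff w m" for l
  proof -
    let ?slack = "\<lambda>l k. max 0 (wdiff w k - l) * z k - (wdiff w k - l) * t k"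
    \<comment> \<open>At this multiplier \<open>t\<close> is complementary: full above, empty below,
      and at ties the factor \<open>wdiff w k - wdiff w m\<close> is zero.\<close>
    have "(\<Sum>k=1..d. ?slack (wdiff w m) k) = 0"
      by (intro sum.neutral) (auto simp: t_def max_def)
    moreover have "0 < (\<Sum>k=1..d. ?slack l k)"
    proof (rule sum_pos2[OF _ m])
      \<comment> \<open>Since \<open>t m = z m / 2\<close>, this slack equals
        \<open>\<bar>wdiff w m - l\<bar> * z m / 2\<close>.\<close>
      show "0 < ?slack l m"
        using l z[OF m] by (auto simp: t_def max_def mult_less_0_iff not_le)
    qed (use t slack_nonneg in auto)
    ultimately show ?thesis unfolding dual_value_primal_slack[OF refl] by linarith
  qed
  ultimately show thesis using that by blast
qed

lemma finite_strict_lower_bound: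
  fixes f :: "'a \<Rightarrow> real"
  assumes "finite A" "\<And>a. a \<in> A \<Longrightarrow> c < f a"
  obtains y where "c < y" "\<And>a. a \<in> A \<Longrightarrow> y \<le> f a"
  \<comment> \<open>Inserting \<open>c + 1\<close> keeps the minimum defined for empty
    \<open>A\<close>, which occurs below when all mapping constraints coincide.\<close>
  using that[of "Min (insert (c + 1) (f ` A))"] assms by auto

lemma mapping_constraint_nonredundant:
  assumes "1 \<le> d"
    and \<sigma>: "\<forall>i\<in>{1..\<tau>}. bij_betw (\<sigma> i) {1..d} {1..d}"
    and mono: "\<forall>i\<in>{1..\<tau>}. mono_on {1..d} (\<lambda>k. wdiff (\<lambda>k. w k i) (\<sigma> i k))"
    and K: "K \<in> {1..\<tau>} \<rightarrow>\<^sub>E {1..d}"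
  shows "nonredundant (simplex2_power \<tau> \<times> UNIV \<times> std_simplex d) ({1..\<tau>} \<rightarrow>\<^sub>E {1..d})
    (mapping_constraint \<tau> d w b \<sigma>) K"
proof -
  let ?I = "{1..\<tau>} \<rightarrow>\<^sub>E {1..d}" and ?S = "simplex2_power \<tau> \<times> (UNIV :: real set) \<times> std_simplex d"
  let ?C = "mapping_constraint \<tau> d w b \<sigma>"
  let ?J = "{L \<in> ?I. {p \<in> ?S. ?C L p} \<noteq> {p \<in> ?S. ?C K p}}"
  define mult where "mult L i = wdiff (\<lambda>k. w k i) (\<sigma> i (L i))" for L i
  note C_iff = mapping_constraint_iff_dual_value[OF \<sigma> mono, folded mult_def]
  \<comment> \<open>The uniform point has positive entries, as \<open>unique_dual_minimiser\<close>
    asks.\<close>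
  define z where "z = (\<lambda>k\<in>{1..d}. 1 / real d)"
  have z: "z \<in> std_simplex d" using \<open>1 \<le> d\<close> by (auto simp: z_def std_simplex_def)
  have "\<exists>r. 0 \<le> r \<and> r \<le> 1 \<and> (\<forall>l. l \<noteq> mult K i \<longrightarrow>
      dual_value d (\<lambda>k. w k i) r z (mult K i) < dual_value d (\<lambda>k. w k i) r z l)"
    if i: "i \<in> {1..\<tau>}" for i
  proof -
    have "\<sigma> i (K i) \<in> {1..d}" using bij_betwE[OF bspec[OF \<sigma> i]] PiE_mem[OF K i] by blast
    moreover have "0 < z k" if "k \<in> {1..d}" for k using that by (auto simp: z_def)
    ultimately show ?thesis
      using unique_dual_minimiser[of d z "\<sigma> i (K i)" "\<lambda>k. w k i"] std_simplex_sum[OF z]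
      unfolding mult_def by metis
  qed
  then obtain r where r: "\<And>i. i \<in> {1..\<tau>} \<Longrightarrow> 0 \<le> r i \<and> r i \<le> 1"
    and less: "\<And>i l. i \<in> {1..\<tau>} \<Longrightarrow> l \<noteq> mult K i \<Longrightarrow>
      dual_value d (\<lambda>k. w k i) (r i) z (mult K i) < dual_value d (\<lambda>k. w k i) (r i) z l" by metis
  define x where "x = (\<lambda>i\<in>{1..\<tau>}. \<lambda>j\<in>{1..2::nat}. if j = 1 then r i else 1 - r i)"
  have x: "x \<in> simplex2_power \<tau>"
    unfolding simplex2_power_def x_def
    using r by (intro restrict_PiE_iff[THEN iffD2] ballI std_simplex_2I) auto
  have x1: "x i 1 = r i" if "i \<in> {1..\<tau>}" for i using that by (simp add: x_def)
  define rhs where "rhs L = (\<Sum>i=1..\<tau>. dual_value d (\<lambda>k. w k i) (x i 1) z (mult L i))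
      + (\<Sum>k=1..d. b k * z k)" for L
  have "rhs K < rhs L" if L: "L \<in> ?J" for L
  proof -
    \<comment> \<open>Equal multipliers in all blocks would give the same constraint, and
      \<open>?J\<close> contains none that cuts out the same set as \<open>K\<close>.\<close>
    obtain i where i: "i \<in> {1..\<tau>}" "mult L i \<noteq> mult K i"
    proof (rule ccontr)
      assume "\<not> thesis"
      then have "\<And>i. i \<in> {1..\<tau>} \<Longrightarrow> mult L i = mult K i" using that by blast
      then have "?C L p = ?C K p" for p
        using C_iff[of K] C_iff[of L] K L by (cases p) simp
      then show False using L by simp
    qed
    \<comment> \<open>No block can compensate for the strict gain in block \<open>i\<close>, since
      the multiplier of \<open>K\<close> is minimal in each.\<close>
    have "dual_value d (\<lambda>k. w k i) (x i 1) z (mult K i) \<le> dual_value d (\<lambda>k. w k i) (x i 1) z (mult L i)"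
      if "i \<in> {1..\<tau>}" for i
      using less[OF that, of "mult L i"] x1[OF that] by (cases "mult L i = mult K i") auto
    moreover have "dual_value d (\<lambda>k. w k i) (x i 1) z (mult K i) < dual_value d (\<lambda>k. w k i) (x i 1) z (mult L i)"
      using less[OF i] x1[OF i(1)] by simp
    ultimately show ?thesis
      unfolding rhs_def using i(1) by (intro add_strict_right_mono sum_strict_mono_ex1) auto
  qed
  moreover have "finite ?J" by (rule finite_subset[of _ ?I]) (auto intro: finite_PiE)
  \<comment> \<open>This \<open>y\<close> violates the constraint of \<open>K\<close> at the witness
    but satisfies every constraint in \<open>?J\<close>.\<close>
  ultimately obtain y where y: "rhs K < y" "\<And>L. L \<in> ?J \<Longrightarrow> y \<le> rhs L"
    using finite_strict_lower_bound[of ?J "rhs K" rhs] by blast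
  have C_rhs: "?C L (x, y, z) \<longleftrightarrow> y \<le> rhs L" if "L \<in> ?I" for L
    using C_iff[OF that] by (simp add: rhs_def)
  have "(x, y, z) \<in> solution_set ?S ?J ?C"
    using x z y(2) C_rhs by (simp add: solution_set_def)
  moreover have "(x, y, z) \<notin> solution_set ?S ?I ?C"
    using y(1) C_rhs[OF K] K by (auto simp: solution_set_def)
  moreover have "solution_set ?S ?I ?C \<subseteq> solution_set ?S ?J ?C"
    by (auto simp: solution_set_def)
  ultimately show ?thesis unfolding nonredundant_def by blast
qed

theorem corollary3:
  shows
    "(\<forall>(d::nat) (w :: nat \<Rightarrow> nat \<Rightarrow> real).
        1 \<le> d \<and> mono_on {1..d} (wdiff w) \<longrightarrow>
        (\<forall>x\<in>std_simplex 2. \<forall>z\<in>std_simplex d.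
           transport 2 d x z w = (MIN K\<in>{1..d}. threshold_value d w x z K)))
     \<and>
     (\<exists>(P :: com) (T :: nat \<Rightarrow> nat).
        (\<lambda>d. real (T d)) \<in> O(\<lambda>d. real d) \<and>
        (\<forall>(d::nat) (w :: nat \<Rightarrow> nat \<Rightarrow> real).
           1 \<le> d \<and> mono_on {1..d} (wdiff w) \<longrightarrow>
           (\<forall>x\<in>std_simplex 2. \<forall>z\<in>std_simplex d. \<forall>s. holds_input s d w x z \<longrightarrow>
              (\<exists>t s'. runs P s t s' \<and> t \<le> T d \<and> ints s' ''K'' \<in> {1..d} \<and>
                 threshold_value d w x z (ints s' ''K'')
                   = (MIN K\<in>{1..d}. threshold_value d w x z K)))))
     \<and>
     (\<forall>(\<tau>::nat) (d::nat) (w :: nat \<Rightarrow> nat \<Rightarrow> nat \<Rightarrow> real) (b :: nat \<Rightarrow> real) (\<sigma> :: nat \<Rightarrow> nat \<Rightarrow> nat).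
        1 \<le> \<tau> \<and> 1 \<le> d \<and>
        (\<forall>i\<in>{1..\<tau>}. bij_betw (\<sigma> i) {1..d} {1..d} \<and>
           mono_on {1..d} (\<lambda>k. wdiff (\<lambda>k. w k i) (\<sigma> i k))) \<longrightarrow>
        (\<forall>x\<in>simplex2_power \<tau>. \<forall>y. \<forall>z\<in>std_simplex d.
           (\<forall>\<alpha>. alpha_constraint \<tau> d w b \<alpha> (x, y, z))
           \<longleftrightarrow> (\<forall>K\<in>{1..\<tau>} \<rightarrow>\<^sub>E {1..d}. mapping_constraint \<tau> d w b \<sigma> K (x, y, z)))
        \<and>
        (\<forall>K\<in>{1..\<tau>} \<rightarrow>\<^sub>E {1..d}.
           nonredundant (simplex2_power \<tau> \<times> UNIV \<times> std_simplex d) ({1..\<tau>} \<rightarrow>\<^sub>E {1..d})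
             (mapping_constraint \<tau> d w b \<sigma>) K))"
proof (intro conjI)
  show "\<exists>(P :: com) (T :: nat \<Rightarrow> nat).
        (\<lambda>d. real (T d)) \<in> O(\<lambda>d. real d) \<and>
        (\<forall>(d::nat) (w :: nat \<Rightarrow> nat \<Rightarrow> real).
           1 \<le> d \<and> mono_on {1..d} (wdiff w) \<longrightarrow>
           (\<forall>x\<in>std_simplex 2. \<forall>z\<in>std_simplex d. \<forall>s. holds_input s d w x z \<longrightarrow>
              (\<exists>t s'. runs P s t s' \<and> t \<le> T d \<and> ints s' ''K'' \<in> {1..d} \<and>
                 threshold_value d w x z (ints s' ''K'')
                   = (MIN K\<in>{1..d}. threshold_value d w x z K))))"
  proof (intro exI conjI)
    show "(\<lambda>d. real (18 * d + 5)) \<in> O(\<lambda>d. real d)"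
      \<comment> \<open>For \<open>1 \<le> d\<close> the bound \<open>18 * d + 5\<close> is at most
        \<open>23 * d\<close>.\<close>
      by (intro bigoI[of _ 23] eventually_sequentiallyI[of 1]) auto
  qed (use scan_correct in blast)
qed (use transport_eq_Min alpha_constraints_iff_mapping_constraints mapping_constraint_nonredundant
  in \<open>(blast | simp)+\<close>)

end
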